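(* Let $\mathbb{F}$ be $\mathbb{R}$ or $\mathbb{C}$. Let $n\ge1$ and let $\bm{a}=(a_0,a_1,\ldots,a_n)$ be a tuple of positive integers with $a_0=1$ and $a_1>\cdots>a_n\ge2$. Let $\bm{c}_i=(c_{i,0},c_{i,1},\ldots,c_{i,n})\in\mathbb{F}^{n+1}$, $1\le i\le d$, be such that $c_{1,0},\ldots,c_{d,0}$ are not all zero. For $0\le m\le a_1$ let $$q_{n,m}=\sum\frac{\bm{c}_1^{\bm{\gamma}_1}\cdots\bm{c}_d^{\bm{\gamma}_d}}{\bm{\gamma}_1!\cdots\bm{\gamma}_d!}\,x_1^{\|\bm{\gamma}_1\|_1}\cdots x_d^{\|\bm{\gamma}_d\|_1}\in\mathbb{F}[x_1,\ldots,x_d],$$ where the sum runs over all $(\bm{\gamma}_1,\ldots,\bm{\gamma}_d)\in(\mathbb{N}^{n+1})^d$, $\bm{\gamma}_i=(\gamma_{i,0},\ldots,\gamma_{i,n})$, with $\sum_{j=0}^na_j\sum_{i=1}^d\gamma_{i,j}=m$. Let $h$ be a nonzero number in $\mathbb{F}$. Then for every $p\in\mathbb{F}[x_1,\ldots,x_d]$, every $\bm{\xi}\in\mathbb{F}^d$ and every $0\le m\le a_1$, $$\frac{1}{m!\,h^m}\sum_{r=0}^m(-1)^{m-r}\binom{m}{r}\,p\Big(\bm{\xi}+\Big(\sum_{j=0}^nc_{1,j}(rh)^{a_j},\ldots,\sum_{j=0}^nc_{d,j}(rh)^{a_j}\Big)\Big)=(q_{n,m}(D)p)(\bm{\xi}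)+O(h).$$
   Context: $\mathbb{N}$ is the set of nonnegative integers. For $\bm{\gamma}_i\in\mathbb{N}^{n+1}$: $\|\bm{\gamma}_i\|_1=\sum_{j=0}^n\gamma_{i,j}$, $\bm{\gamma}_i!=\prod_{j=0}^n\gamma_{i,j}!$, and $\bm{c}_i^{\bm{\gamma}_i}=\prod_{j=0}^nc_{i,j}^{\gamma_{i,j}}$ (with $0^0=1$). For a polynomial $q=\sum_{\bm{\alpha}\in\mathbb{N}^d}\widehat q(\bm{\alpha})\bm{x}^{\bm{\alpha}}$, $q(D)$ is the differential operator $f\mapsto\sum_{\bm{\alpha}}\widehat q(\bm{\alpha})\,\partial^{\alpha_1+\cdots+\alpha_d}f/\partial x_1^{\alpha_1}\cdots\partial x_d^{\alpha_d}$. $O(h)$ is understood as $h\to0$ in $\mathbb{F}$, with all other data ($\bm{a}$, $\bm{c}_i$, $p$, $\bm{\xi}$, $m$) fixed. *)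

theory Defs
  imports "HOL-Analysis.Analysis" "HOL-Library.Poly_Mapping" "HOL-Library.Landau_Symbols"
begin

text \<open>
  The variables \<open>x\<^sub>1, \<dots>, x\<^sub>d\<close> are indexed by a finite linearly ordered type \<open>'d\<close> with
  \<open>d = CARD('d)\<close>. A polynomial is the finitely supported map sending each multi-index in
  \<open>nat ^ 'd\<close> to its coefficient, so that \<open>Poly_Mapping.lookup p \<alpha>\<close> is the coefficient of
  the monomial with exponent \<open>\<alpha>\<close>.
\<close>

type_synonym ('a, 'd) mpolynomial = "(nat ^ 'd) \<Rightarrow>\<^sub>0 'a"

definition mpoly_eval ::
  "('a::comm_semiring_1, 'd::finite) mpolynomial \<Rightarrow> 'a ^ 'd \<Rightarrow> 'a" where
  "mpoly_eval p x =
     (\<Sum>\<alpha>\<in>Poly_Mapping.keys p. Poly_Mapping.lookup p \<alpha> * (\<Prod>i\<in>UNIV. (x $ i) ^ (\<alpha> $ i)))"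

definition partial_deriv ::
  "'d::finite \<Rightarrow> ('a::real_normed_field ^ 'd \<Rightarrow> 'a) \<Rightarrow> 'a ^ 'd \<Rightarrow> 'a" where
  "partial_deriv i f x = deriv (\<lambda>t. f (\<chi> k. if k = i then t else x $ k)) (x $ i)"

definition mixed_deriv ::
  "nat ^ 'd::{finite,linorder} \<Rightarrow> ('a::real_normed_field ^ 'd::{finite,linorder} \<Rightarrow> 'a) \<Rightarrow>
     'a ^ 'd::{finite,linorder} \<Rightarrow> 'a" where
  "mixed_deriv \<alpha> f =
     foldr (\<lambda>i. partial_deriv i ^^ (\<alpha> $ i)) (sorted_list_of_set (UNIV :: 'd set)) f"

definition diff_op ::
  "('a::real_normed_field, 'd::{finite,linorder}) mpolynomial \<Rightarrow>
     ('a ^ 'd::{finite,linorder} \<Rightarrow> 'a) \<Rightarrow> 'a ^ 'd::{finite,linorder} \<Rightarrow> 'a"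
  where
  "diff_op q f x =
     (\<Sum>\<alpha>\<in>Poly_Mapping.keys q. Poly_Mapping.lookup q \<alpha> * mixed_deriv \<alpha> f x)"

text \<open>
  A tuple in \<open>(\<nat>\<^sup>n\<^sup>+\<^sup>1)\<^sup>d\<close> is represented by the unique function \<open>\<gamma> :: 'd \<Rightarrow> nat \<Rightarrow> nat\<close> extending it
  by \<open>0\<close> to second arguments \<open>j > n\<close>.
\<close>

definition weight_tuples :: "nat \<Rightarrow> (nat \<Rightarrow> nat) \<Rightarrow> nat \<Rightarrow> ('d::finite \<Rightarrow> nat \<Rightarrow> nat) set" where
  "weight_tuples n a m =
     {\<gamma>. (\<forall>i. \<forall>j>n. \<gamma> i j = 0) \<and> (\<Sum>j\<le>n. a j * (\<Sum>i\<in>UNIV. \<gamma> i j)) = m}"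

lemma finite_weight_tuples:
  assumes "\<And>j. j \<le> n \<Longrightarrow> a j > 0"
  shows "finite (weight_tuples n a m :: ('d::finite \<Rightarrow> nat \<Rightarrow> nat) set)"
proof -
  let ?R = "{g :: nat \<Rightarrow> nat. \<forall>j. (j \<in> {..n} \<longrightarrow> g j \<in> {..m}) \<and> (j \<notin> {..n} \<longrightarrow> g j = 0)}"
  let ?S = "{\<gamma> :: 'd \<Rightarrow> nat \<Rightarrow> nat. \<forall>i. (i \<in> UNIV \<longrightarrow> \<gamma> i \<in> ?R) \<and> (i \<notin> UNIV \<longrightarrow> \<gamma> i = (\<lambda>_. 0))}"
  have "finite ?R"
    by (rule finite_set_of_finite_funs) auto
  then have "finite ?S"
    by (intro finite_set_of_finite_funs) auto
  moreover have "weight_tuples n a m \<subseteq> ?S"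
  proof
    fix \<gamma> :: "'d \<Rightarrow> nat \<Rightarrow> nat"
    assume "\<gamma> \<in> weight_tuples n a m"
    then have out: "\<And>i j. j > n \<Longrightarrow> \<gamma> i j = 0"
      and total: "(\<Sum>j\<le>n. a j * (\<Sum>i\<in>UNIV. \<gamma> i j)) = m"
      by (auto simp: weight_tuples_def)
    have "\<gamma> i j \<le> m" if "j \<le> n" for i j
    proof -
      have "\<gamma> i j \<le> (\<Sum>i\<in>UNIV. \<gamma> i j)"
        by (rule member_le_sum) auto
      also have "\<dots> \<le> a j * (\<Sum>i\<in>UNIV. \<gamma> i j)"
        using assms[OF that] by simp
      also have "\<dots> \<le> (\<Sum>j\<le>n. a j * (\<Sum>i\<in>UNIV. \<gamma> i j))"
        by (rule member_le_sum[where f = "\<lambda>j. a j * (\<Sum>i\<in>UNIV. \<gamma> i j)"]) (use that in auto)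
      finally show ?thesis
        using total by simp
    qed
    with out show "\<gamma> \<in> ?S"
      by auto
  qed
  ultimately show ?thesis
    by (rule rev_finite_subset)
qed

definition q_poly ::
  "nat \<Rightarrow> (nat \<Rightarrow> nat) \<Rightarrow> ('d::finite \<Rightarrow> nat \<Rightarrow> 'a::field_char_0) \<Rightarrow> nat \<Rightarrow> ('a, 'd) mpolynomial" where
  "q_poly n a c m =
     (\<Sum>\<gamma>\<in>weight_tuples n a m.
        Poly_Mapping.single (\<chi> i. \<Sum>j\<le>n. \<gamma> i j)
          ((\<Prod>i\<in>UNIV. \<Prod>j\<le>n. c i j ^ \<gamma> i j) / (\<Prod>i\<in>UNIV. \<Prod>j\<le>n. fact (\<gamma> i j))))"

end

theory Submission
  imports Defs
begin

text \<open>
  Expand \<open>p\<close> at \<open>\<xi>\<close> by Taylor's formula and the powers of the curve by the multinomial theorem: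
  \<open>p\<close> along the curve is a polynomial in \<open>t = r h\<close> with one term per tuple \<open>\<gamma>\<close>, of degree
  the weight of \<open>\<gamma>\<close>. The \<open>m\<close>-th difference kills the terms of weight below \<open>m\<close> and multiplies those
  of weight \<open>m\<close> by \<open>m! h\<^sup>m\<close>; the latter sum to \<open>(q(D)p)(\<xi>)\<close>, and the remaining terms
  contribute \<open>O(h)\<close>.
\<close>

section \<open>Finite differences of powers at the origin\<close>

text \<open>The \<open>m\<close>-th difference of \<open>x ^ k\<close> at 0. The absorption identity
  \<open>(Suc m choose Suc r) * Suc r = Suc m * (m choose r)\<close> trades one factor of the power
  for a difference of order one less.\<close>

lemma alternating_binomial_power_sum:
  assumes "k \<le> m"
  shows "(\<Sum>r\<le>m. (-1) ^ (m - r) * of_nat (m choose r) * of_nat r ^ k)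
    = (if k = m then fact m else 0 :: 'a::field_char_0)"
  using assms
proof (induction m arbitrary: k)
  case 0
  then show ?case by simp
next
  case (Suc m)
  let ?S = "\<lambda>m k. \<Sum>r\<le>m. (-1) ^ (m - r) * of_nat (m choose r) * of_nat r ^ k :: 'a"
  show ?case
  proof (cases k)
    case 0
    have "?S (Suc m) 0 = (\<Sum>r\<le>Suc m. (-1) ^ Suc m * ((-1) ^ r * of_nat (Suc m choose r)))"
    proof (rule sum.cong)
      fix r assume "r \<in> {..Suc m}"
      then have "(-1::'a) ^ (Suc m - r) = (-1) ^ Suc m * (-1) ^ r"
        by (simp only: minus_one_power_iff flip: power_add) auto
      then show "(-1) ^ (Suc m - r) * of_nat (Suc m choose r) * of_nat r ^ 0
          = (-1) ^ Suc m * ((-1) ^ r * of_nat (Suc m choose r) :: 'a)"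
        by (simp only: mult.assoc power_0 mult_1_right)
    qed simp
    also have "\<dots> = 0"
      by (simp only: choose_alternating_sum[OF zero_less_Suc] flip: sum_distrib_left) simp
    finally show ?thesis using 0 by simp
  next
    case (Suc l)
    have l: "l \<le> m" using Suc Suc.prems by simp
    \<comment> \<open>The term \<open>r = 0\<close> vanishes because the exponent
      \<open>Suc l\<close> is positive, so the index can be shifted.\<close>
    have "?S (Suc m) (Suc l)
        = (\<Sum>r\<le>m. (-1) ^ (m - r) * of_nat (Suc m choose Suc r) * of_nat (Suc r) ^ Suc l)"
      by (subst sum.atMost_Suc_shift) (simp del: binomial_Suc_Suc of_nat_Suc)
    also have "\<dots> = (\<Sum>r\<le>m. of_nat (Suc m) *
        ((-1) ^ (m - r) * of_nat (m choose r) * of_nat (Suc r) ^ l))"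
    proof (rule sum.cong[OF refl])
      fix r
      have "of_nat (Suc m choose Suc r) * of_nat (Suc r) = (of_nat (Suc m) * of_nat (m choose r) :: 'a)"
        by (simp only: Suc_times_binomial_eq flip: of_nat_mult)
      then have "(-1) ^ (m - r) * (of_nat (Suc m choose Suc r) * of_nat (Suc r)) * of_nat (Suc r) ^ l
        = (-1) ^ (m - r) * (of_nat (Suc m) * of_nat (m choose r)) * (of_nat (Suc r) ^ l :: 'a)"
        by (simp only:)
      then show "(-1) ^ (m - r) * of_nat (Suc m choose Suc r) * of_nat (Suc r) ^ Suc l
        = of_nat (Suc m) * ((-1) ^ (m - r) * of_nat (m choose r) * of_nat (Suc r) ^ l :: 'a)"
        by (simp only: power_Suc ac_simps)
    qed
    also have "\<dots> = of_nat (Suc m) * (\<Sum>r\<le>m. \<Sum>i\<le>l.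
        of_nat (l choose i) * ((-1) ^ (m - r) * of_nat (m choose r) * of_nat r ^ i))"
    proof -
      have "of_nat (Suc r) ^ l = (\<Sum>i\<le>l. of_nat (l choose i) * of_nat r ^ i :: 'a)" for r
        using binomial_ring[of "of_nat r :: 'a" 1 l] by (simp add: add.commute)
      then show ?thesis
        by (simp only: flip: sum_distrib_left) (simp only: sum_distrib_left ac_simps)
    qed
    also have "\<dots> = of_nat (Suc m) * (\<Sum>i\<le>l. of_nat (l choose i) * ?S m i)"
      by (subst sum.swap) (simp only: sum_distrib_left)
    \<comment> \<open>By induction only \<open>i = m\<close> survives, and
      \<open>i \<le> l \<le> m\<close> then forces \<open>i = l = m\<close>.\<close>
    also have "(\<Sum>i\<le>l. of_nat (l choose i) * ?S m i)
        = (\<Sum>i\<le>l. if i = m then of_nat (l choose i) * fact m else 0 :: 'a)"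
      using l by (intro sum.cong refl) (simp add: Suc.IH)
    also have "\<dots> = (if l = m then fact m else 0)"
      using l by (auto simp: sum.delta)
    finally show ?thesis using Suc by simp
  qed
qed

section \<open>Binomial and multinomial expansions in divided powers\<close>

text \<open>Dividing by factorials turns the binomial theorem into a plain convolution, which keeps
  the induction for several summands free of coefficients.\<close>

lemma power_add_div_fact:
  fixes x y :: "'a::field_char_0"
  shows "(x + y) ^ k / fact k = (\<Sum>i\<le>k. x ^ i / fact i * (y ^ (k - i) / fact (k - i)))"
  unfolding binomial_ring sum_divide_distrib
  by (intro sum.cong refl) (simp add: binomial_fact)

text \<open>Weak compositions of \<open>k\<close> with parts indexed by \<open>A\<close>. The value
  0 off \<open>A\<close> makes the representation unique, in line with
  \<open>weight_tuples\<close>.\<close>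

definition compositions :: "'b set \<Rightarrow> nat \<Rightarrow> ('b \<Rightarrow> nat) set" where
  "compositions A k = {g. (\<forall>j. j \<notin> A \<longrightarrow> g j = 0) \<and> sum g A = k}"

lemma finite_compositions:
  assumes "finite A"
  shows "finite (compositions A k)"
proof -
  have "g j \<le> k" if "g \<in> compositions A k" "j \<in> A" for g j
    using that assms member_le_sum[of j A g] by (auto simp: compositions_def)
  then have "compositions A k \<subseteq> {g. \<forall>j. (j \<in> A \<longrightarrow> g j \<in> {..k}) \<and> (j \<notin> A \<longrightarrow> g j = 0)}"
    by (auto simp: compositions_def)
  moreover have "finite {g. \<forall>j. (j \<in> A \<longrightarrow> g j \<in> {..k}) \<and> (j \<notin> A \<longrightarrow> g j = 0)}"
    using assms by (intro finite_set_of_finite_funs) auto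
  ultimately show ?thesis by (rule finite_subset)
qed

text \<open>Peel off one summand by the binomial case: a composition over \<open>insert b A\<close>
  is its value at \<open>b\<close> together with a composition of the rest over
  \<open>A\<close>.\<close>

lemma multinomial_div_fact:
  fixes z :: "'b \<Rightarrow> 'a::field_char_0"
  assumes "finite A"
  shows "sum z A ^ k / fact k = (\<Sum>g\<in>compositions A k. \<Prod>j\<in>A. z j ^ g j / fact (g j))"
  using assms
proof (induction A arbitrary: k rule: finite_induct)
  case empty
  have "compositions {} k = (if k = 0 then {\<lambda>_. 0} else {} :: ('b \<Rightarrow> nat) set)"
    by (auto simp: compositions_def)
  then show ?case by simp
next
  case (insert b A)
  let ?P = "\<lambda>A g. \<Prod>j\<in>A. z j ^ g j / fact (g j)"
  have upd: "(\<Sum>j\<in>A. if j = b then i else g j) = sum g A" for g :: "'b \<Rightarrow> nat" and i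
    using insert.hyps by (intro sum.cong) auto
  have updP: "?P A (\<lambda>j. if j = b then i else g j) = ?P A g" for g i
    using insert.hyps by (intro prod.cong) auto
  have "sum z (insert b A) ^ k / fact k
      = (\<Sum>i\<le>k. z b ^ i / fact i * (\<Sum>g\<in>compositions A (k - i). ?P A g))"
    using insert by (simp add: power_add_div_fact)
  also have "\<dots> = (\<Sum>(i, g)\<in>(SIGMA i:{..k}. compositions A (k - i)). z b ^ i / fact i * ?P A g)"
    by (subst sum.Sigma[symmetric]) (simp_all add: insert.hyps finite_compositions sum_distrib_left)
  also have "\<dots> = (\<Sum>g\<in>compositions (insert b A) k. ?P (insert b A) g)"
  \<comment> \<open>The entry at \<open>b\<close> is reset to 0 because compositions over
    \<open>A\<close> must vanish there.\<close>
  proof (rule sum.reindex_bij_witness[of _ "\<lambda>g. (g b, g(b := 0))" "\<lambda>(i, g). g(b := i)"])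
    show "(case (\<lambda>(i, g). g(b := i)) x of g \<Rightarrow> (g b, g(b := 0))) = x"
      if "x \<in> (SIGMA i:{..k}. compositions A (k - i))" for x
      using that insert.hyps by (auto simp: compositions_def fun_eq_iff)
  qed (use insert.hyps in \<open>auto simp: compositions_def upd updP\<close>)
  finally show ?case .
qed

section \<open>Falling factorials and derivatives of polynomials\<close>

text \<open>The falling factorial \<open>e (e-1) ... (e-b+1)\<close>, the coefficient in the
  \<open>b\<close>-th derivative of \<open>x ^ e\<close>.\<close>

definition falling :: "nat \<Rightarrow> nat \<Rightarrow> nat" where
  "falling e b = (e choose b) * fact b"

lemma falling_0 [simp]: "falling e 0 = 1"
  by (simp add: falling_def)

text \<open>Truncated subtraction is harmless: for \<open>b \<ge> e\<close> both sides are
  0.\<close>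

lemma falling_Suc: "falling e (Suc b) = falling e b * (e - b)"
proof -
  have "(e choose Suc b) * Suc b = (e choose b) * (e - b)"
  proof (cases "b \<le> e")
    case True
    then show ?thesis
      using binomial_absorb_comp[of e b] binomial_absorption[of b e] by (simp add: mult.commute)
  qed simp
  then have "(e choose Suc b) * Suc b * fact b = (e choose b) * (e - b) * fact b"
    by (simp only:)
  then show ?thesis
    by (simp only: falling_def fact_Suc of_nat_id ac_simps)
qed

text \<open>Taylor's formula for a power. Terms with \<open>k > e\<close> vanish, so one bound
  \<open>N\<close> can give all monomials of a polynomial the same range of summation.\<close>

lemma power_add_falling:
  fixes x y :: "'a::field_char_0"
  assumes "e \<le> N"
  shows "(x + y) ^ e = (\<Sum>k\<le>N. of_nat (falling e k) * x ^ (e - k) * (y ^ k / fact k))"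
proof -
  have "(x + y) ^ e = (\<Sum>k\<le>e. of_nat (falling e k) * x ^ (e - k) * (y ^ k / fact k))"
    by (subst add.commute, subst binomial_ring, intro sum.cong refl)
      (simp add: falling_def field_simps)
  also have "\<dots> = (\<Sum>k\<le>N. of_nat (falling e k) * x ^ (e - k) * (y ^ k / fact k))"
    using assms by (intro sum.mono_neutral_left) (auto simp: falling_def)
  finally show ?thesis .
qed

text \<open>
  The derivative of order \<open>\<beta>\<close>. As \<open>falling e b = 0\<close> for \<open>b > e\<close>, the truncated exponents
  \<open>\<alpha> $ i - \<beta> i\<close> are harmless.
\<close>
definition mpoly_deriv ::
  "('a::comm_semiring_1, 'd::finite) mpolynomial \<Rightarrow> ('d \<Rightarrow> nat) \<Rightarrow> 'a ^ 'd \<Rightarrow> 'a" where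
  "mpoly_deriv p \<beta> x = (\<Sum>\<alpha>\<in>Poly_Mapping.keys p. Poly_Mapping.lookup p \<alpha> *
     (\<Prod>i\<in>UNIV. of_nat (falling (\<alpha> $ i) (\<beta> i)) * (x $ i) ^ (\<alpha> $ i - \<beta> i)))"

text \<open>In each monomial only the \<open>i\<close>-th factor depends on the variable; the
  exponent it brings down is the new factor in \<open>falling_Suc\<close>.\<close>

lemma partial_deriv_mpoly_deriv:
  fixes p :: "('a::real_normed_field, 'd::finite) mpolynomial"
  shows "partial_deriv i (mpoly_deriv p \<beta>) = mpoly_deriv p (\<beta>(i := Suc (\<beta> i)))"
proof
  fix x :: "'a ^ 'd"
  let ?f = "\<lambda>\<beta> x \<alpha> k. of_nat (falling (\<alpha> $ k) (\<beta> k)) * (x $ k) ^ (\<alpha> $ k - \<beta> k) :: 'a"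
  let ?R = "\<lambda>\<alpha>. \<Prod>k\<in>UNIV - {i}. ?f \<beta> x \<alpha> k"
  have split: "prod g UNIV = g i * prod g (UNIV - {i})" for g :: "'d \<Rightarrow> 'a"
    by (rule prod.remove) auto
  have "mpoly_deriv p \<beta> (\<chi> k. if k = i then t else x $ k)
      = (\<Sum>\<alpha>\<in>Poly_Mapping.keys p. Poly_Mapping.lookup p \<alpha> *
          (of_nat (falling (\<alpha> $ i) (\<beta> i)) * t ^ (\<alpha> $ i - \<beta> i) * ?R \<alpha>))" for t
    unfolding mpoly_deriv_def split by (intro sum.cong arg_cong2[of _ _ _ _ "(*)"] prod.cong) auto
  moreover have "((\<lambda>t. \<Sum>\<alpha>\<in>Poly_Mapping.keys p. Poly_Mapping.lookup p \<alpha> *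
          (of_nat (falling (\<alpha> $ i) (\<beta> i)) * t ^ (\<alpha> $ i - \<beta> i) * ?R \<alpha>))
     has_field_derivative mpoly_deriv p (\<beta>(i := Suc (\<beta> i))) x) (at (x $ i))"
  proof -
    have "prod (?f (\<beta>(i := Suc (\<beta> i))) x \<alpha>) (UNIV - {i}) = ?R \<alpha>" for \<alpha>
      by (intro prod.cong) auto
    then show ?thesis
      unfolding mpoly_deriv_def split
      by (auto intro!: derivative_eq_intros sum.cong simp: falling_Suc)
  qed
  ultimately show "partial_deriv i (mpoly_deriv p \<beta>) x = mpoly_deriv p (\<beta>(i := Suc (\<beta> i))) x"
    unfolding partial_deriv_def by (simp add: DERIV_imp_deriv)
qed

lemma partial_deriv_funpow_mpoly_deriv:
  fixes p :: "('a::real_normed_field, 'd::finite) mpolynomial"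
  shows "(partial_deriv i ^^ k) (mpoly_deriv p \<beta>) = mpoly_deriv p (\<beta>(i := \<beta> i + k))"
proof (induction k)
  case (Suc k)
  show ?case
    by (simp only: funpow.simps o_apply Suc.IH partial_deriv_mpoly_deriv fun_upd_upd fun_upd_same
        add_Suc_right)
qed simp

lemma mixed_deriv_mpoly_eval:
  fixes p :: "('a::real_normed_field, 'd::{finite,linorder}) mpolynomial"
  shows "mixed_deriv \<alpha> (mpoly_eval p) = mpoly_deriv p (($) \<alpha>)"
proof -
  \<comment> \<open>Generalised to a distinct list: the order at \<open>i\<close> is still 0 when
    its only turn comes, and then becomes \<open>\<alpha> $ i\<close>.\<close>
  have "foldr (\<lambda>i. partial_deriv i ^^ (\<alpha> $ i)) xs (mpoly_eval p)
      = mpoly_deriv p (\<lambda>i. if i \<in> set xs then \<alpha> $ i else 0)" if "distinct xs" for xs :: "'d list"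
    using that
  proof (induction xs)
    case Nil
    show ?case by (simp add: fun_eq_iff mpoly_eval_def mpoly_deriv_def)
  next
    case (Cons i xs)
    then show ?case
      by (auto simp: partial_deriv_funpow_mpoly_deriv intro!: arg_cong[of _ _ "mpoly_deriv p"])
  qed
  then show ?thesis by (simp add: mixed_deriv_def)
qed

section \<open>The operator of a sum of monomials\<close>

lemma diff_op_superset:
  assumes "finite S" "Poly_Mapping.keys q \<subseteq> S"
  shows "diff_op q f x = (\<Sum>\<alpha>\<in>S. Poly_Mapping.lookup q \<alpha> * mixed_deriv \<alpha> f x)"
  unfolding diff_op_def using assms
  by (intro sum.mono_neutral_left) (auto simp: in_keys_iff)

lemma diff_op_sum_single:
  assumes "finite W"
  shows "diff_op (\<Sum>\<gamma>\<in>W. Poly_Mapping.single (\<beta> \<gamma>) (B \<gamma>)) f x = (\<Sum>\<gamma>\<in>W. B \<gamma> * mixed_deriv (\<beta> \<gamma>) f x)"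
proof -
  let ?q = "\<Sum>\<gamma>\<in>W. Poly_Mapping.single (\<beta> \<gamma>) (B \<gamma>)"
  \<comment> \<open>Coefficients with a common exponent may cancel, so all exponents are added to
    the keys; after swapping the sums each \<open>\<gamma>\<close> meets its own exponent exactly
    once.\<close>
  let ?S = "Poly_Mapping.keys ?q \<union> \<beta> ` W"
  have S: "finite ?S" using assms by simp
  have "diff_op ?q f x = (\<Sum>\<alpha>\<in>?S. \<Sum>\<gamma>\<in>W. if \<alpha> = \<beta> \<gamma> then B \<gamma> * mixed_deriv \<alpha> f x else 0)"
    by (subst diff_op_superset[OF S Un_upper1], intro sum.cong refl)
      (auto simp: lookup_sum lookup_single when_def sum_distrib_right intro!: sum.cong)
  also have "\<dots> = (\<Sum>\<gamma>\<in>W. B \<gamma> * mixed_deriv (\<beta> \<gamma>) f x)"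
    using S by (subst sum.swap) (intro sum.cong, auto simp: sum.delta)
  finally show ?thesis .
qed

section \<open>Expansion of the polynomial along the curve\<close>

text \<open>One row per coordinate, each of total at most \<open>N\<close>. The product form is what
  multiplying out a product of sums over rows yields.\<close>

definition bounded_tuples :: "nat \<Rightarrow> nat \<Rightarrow> ('d::finite \<Rightarrow> nat \<Rightarrow> nat) set" where
  "bounded_tuples n N = (\<Pi>\<^sub>E i\<in>UNIV. \<Union>k\<le>N. compositions {..n} k)"

lemma finite_bounded_tuples: "finite (bounded_tuples n N)"
  by (auto simp: bounded_tuples_def finite_compositions intro!: finite_PiE)

lemma bounded_tuples_eq_0:
  assumes "\<gamma> \<in> bounded_tuples n N" "n < j"
  shows "\<gamma> i j = 0"
proof -
  have "\<gamma> i \<in> (\<Union>k\<le>N. compositions {..n} k)"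
    using assms(1) unfolding bounded_tuples_def by (rule PiE_mem) simp
  then show ?thesis using assms(2) by (auto simp: compositions_def)
qed

text \<open>Each coordinate of each monomial is expanded separately. As \<open>N\<close> bounds all
  exponents, this is exact with one index set for all monomials.\<close>

lemma mpoly_eval_along_curve:
  fixes p :: "('a::real_normed_field, 'd::{finite,linorder}) mpolynomial"
  assumes N: "\<And>\<alpha> i. \<alpha> \<in> Poly_Mapping.keys p \<Longrightarrow> \<alpha> $ i \<le> N"
  shows "mpoly_eval p (\<xi> + (\<chi> i. \<Sum>j\<le>n. c i j * t ^ a j)) =
    (\<Sum>\<gamma>\<in>bounded_tuples n N.
       ((\<Prod>i\<in>UNIV. \<Prod>j\<le>n. c i j ^ \<gamma> i j) / (\<Prod>i\<in>UNIV. \<Prod>j\<le>n. fact (\<gamma> i j))) *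
       mixed_deriv (\<chi> i. \<Sum>j\<le>n. \<gamma> i j) (mpoly_eval p) \<xi> *
       t ^ (\<Sum>j\<le>n. a j * (\<Sum>i\<in>UNIV. \<gamma> i j)))"
proof -
  let ?G = "\<Union>k\<le>N. compositions {..n} k"
  let ?M = "\<lambda>i g. \<Prod>j\<le>n. (c i j * t ^ a j) ^ g j / fact (g j)"
  let ?B = "\<lambda>\<gamma>. (\<Prod>i\<in>UNIV. \<Prod>j\<le>n. c i j ^ \<gamma> i j) / (\<Prod>i\<in>UNIV. \<Prod>j\<le>n. fact (\<gamma> i j)) :: 'a"
  let ?w = "\<lambda>\<gamma>. \<Sum>j\<le>n. a j * (\<Sum>i\<in>UNIV. \<gamma> i j)"
  have coord: "(\<xi> $ i + (\<Sum>j\<le>n. c i j * t ^ a j)) ^ e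
      = (\<Sum>g\<in>?G. of_nat (falling e (\<Sum>j\<le>n. g j)) * (\<xi> $ i) ^ (e - (\<Sum>j\<le>n. g j)) * ?M i g)"
    if "e \<le> N" for i e
  proof -
    have "(\<xi> $ i + (\<Sum>j\<le>n. c i j * t ^ a j)) ^ e = (\<Sum>k\<le>N. \<Sum>g\<in>compositions {..n} k.
        of_nat (falling e k) * (\<xi> $ i) ^ (e - k) * ?M i g)"
      unfolding power_add_falling[OF that] by (simp add: multinomial_div_fact sum_distrib_left)
    \<comment> \<open>Here \<open>k\<close> is the total of \<open>g\<close>; once the terms depend
      on \<open>g\<close> alone, the double sum becomes one over a disjoint union.\<close>
    also have "\<dots> = (\<Sum>k\<le>N. \<Sum>g\<in>compositions {..n} k.
        of_nat (falling e (\<Sum>j\<le>n. g j)) * (\<xi> $ i) ^ (e - (\<Sum>j\<le>n. g j)) * ?M i g)"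
      by (intro sum.cong refl) (simp add: compositions_def)
    also have "\<dots> = (\<Sum>g\<in>?G. of_nat (falling e (\<Sum>j\<le>n. g j)) *
        (\<xi> $ i) ^ (e - (\<Sum>j\<le>n. g j)) * ?M i g)"
      by (rule sum.UNION_disjoint[symmetric])
        (simp_all add: finite_compositions, auto simp: compositions_def)
    finally show ?thesis .
  qed
  \<comment> \<open>The powers of \<open>t\<close> from all coordinates combine into the weight of
    the tuple.\<close>
  have M: "(\<Prod>i\<in>UNIV. ?M i (\<gamma> i)) = ?B \<gamma> * t ^ ?w \<gamma>" for \<gamma> :: "'d \<Rightarrow> nat \<Rightarrow> nat"
  proof -
    have "?w \<gamma> = (\<Sum>i\<in>UNIV. \<Sum>j\<le>n. a j * \<gamma> i j)"
      by (subst sum.swap) (simp add: sum_distrib_left)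
    then show ?thesis
      by (simp add: power_mult_distrib prod.distrib prod_dividef power_sum flip: power_mult)
  qed
  have "mpoly_eval p (\<xi> + (\<chi> i. \<Sum>j\<le>n. c i j * t ^ a j)) =
     (\<Sum>\<alpha>\<in>Poly_Mapping.keys p. Poly_Mapping.lookup p \<alpha> * (\<Prod>i\<in>UNIV. \<Sum>g\<in>?G.
        of_nat (falling (\<alpha> $ i) (\<Sum>j\<le>n. g j)) * (\<xi> $ i) ^ (\<alpha> $ i - (\<Sum>j\<le>n. g j)) * ?M i g))"
    unfolding mpoly_eval_def
    by (intro sum.cong refl arg_cong2[of _ _ _ _ "(*)"] prod.cong) (simp add: coord N)
  \<comment> \<open>Choosing one row for each coordinate amounts to choosing a tuple.\<close>
  also have "\<dots> = (\<Sum>\<alpha>\<in>Poly_Mapping.keys p. \<Sum>\<gamma>\<in>bounded_tuples n N.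
      Poly_Mapping.lookup p \<alpha> * ((\<Prod>i\<in>UNIV. of_nat (falling (\<alpha> $ i) (\<Sum>j\<le>n. \<gamma> i j)) *
        (\<xi> $ i) ^ (\<alpha> $ i - (\<Sum>j\<le>n. \<gamma> i j))) * (?B \<gamma> * t ^ ?w \<gamma>)))"
    unfolding bounded_tuples_def M[symmetric]
    by (subst prod_sum_PiE) (auto simp: finite_compositions prod.distrib sum_distrib_left)
  \<comment> \<open>With \<open>\<gamma>\<close> outside, the sum over \<open>\<alpha>\<close> is a
    derivative of \<open>p\<close> at \<open>\<xi>\<close>.\<close>
  also have "\<dots> = (\<Sum>\<gamma>\<in>bounded_tuples n N. ?B \<gamma> *
      mixed_deriv (\<chi> i. \<Sum>j\<le>n. \<gamma> i j) (mpoly_eval p) \<xi> * t ^ ?w \<gamma>)"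
    unfolding mixed_deriv_mpoly_eval mpoly_deriv_def
    by (subst sum.swap) (simp add: sum_distrib_left sum_distrib_right ac_simps)
  finally show ?thesis .
qed

text \<open>Since every \<open>a j\<close> is at least 1, the weight dominates the total of each
  row.\<close>

lemma weight_tuples_subset_bounded_tuples:
  assumes "\<And>j. j \<le> n \<Longrightarrow> a j > 0" "m \<le> N"
  shows "weight_tuples n a m \<subseteq> (bounded_tuples n N :: ('d::finite \<Rightarrow> nat \<Rightarrow> nat) set)"
proof
  fix \<gamma> :: "'d \<Rightarrow> nat \<Rightarrow> nat" assume \<gamma>: "\<gamma> \<in> weight_tuples n a m"
  have "(\<Sum>j\<le>n. \<gamma> i j) \<le> N" for i
  proof -
    have "\<gamma> i j \<le> a j * (\<Sum>i\<in>UNIV. \<gamma> i j)" if "j \<le> n" for j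
    proof -
      have "\<gamma> i j \<le> (\<Sum>i\<in>UNIV. \<gamma> i j)"
        by (rule member_le_sum) auto
      also have "\<dots> \<le> a j * (\<Sum>i\<in>UNIV. \<gamma> i j)"
        using assms(1)[OF that] by simp
      finally show ?thesis .
    qed
    then have "(\<Sum>j\<le>n. \<gamma> i j) \<le> (\<Sum>j\<le>n. a j * (\<Sum>i\<in>UNIV. \<gamma> i j))"
      by (intro sum_mono) auto
    then show ?thesis using \<gamma> assms(2) by (simp add: weight_tuples_def)
  qed
  then show "\<gamma> \<in> bounded_tuples n N"
    using \<gamma> by (auto simp: bounded_tuples_def compositions_def weight_tuples_def)
qed

section \<open>The difference quotient and its remainder\<close>

lemma difference_quotient_generalized_polynomial:
  fixes A :: "'b \<Rightarrow> 'a::real_normed_field"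
  assumes "finite \<Gamma>"
  shows "(\<lambda>h. 1 / (fact m * h ^ m) * (\<Sum>r\<le>m. (-1) ^ (m - r) * of_nat (m choose r) *
            (\<Sum>\<gamma>\<in>\<Gamma>. A \<gamma> * (of_nat r * h) ^ w \<gamma>))
          - (\<Sum>\<gamma>\<in>{\<gamma>\<in>\<Gamma>. w \<gamma> = m}. A \<gamma>)) \<in> O[at 0](\<lambda>h. h)"
proof -
  let ?S = "\<lambda>k. \<Sum>r\<le>m. (-1) ^ (m - r) * of_nat (m choose r) * of_nat r ^ k :: 'a"
  \<comment> \<open>The remainder: for weights above \<open>m\<close>, dividing by
    \<open>h ^ m\<close> leaves a constant times a positive power of \<open>h\<close>.\<close>
  let ?R = "\<lambda>h. \<Sum>\<gamma>\<in>{\<gamma>\<in>\<Gamma>. m < w \<gamma>}. A \<gamma> * ?S (w \<gamma>) / fact m * h ^ (w \<gamma> - m)"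
  have eq: "1 / (fact m * h ^ m) * (\<Sum>r\<le>m. (-1) ^ (m - r) * of_nat (m choose r) *
            (\<Sum>\<gamma>\<in>\<Gamma>. A \<gamma> * (of_nat r * h) ^ w \<gamma>))
          - (\<Sum>\<gamma>\<in>{\<gamma>\<in>\<Gamma>. w \<gamma> = m}. A \<gamma>) = ?R h" if "h \<noteq> 0" for h :: 'a
  proof -
    let ?T = "\<lambda>\<gamma>. 1 / (fact m * h ^ m) * (A \<gamma> * ?S (w \<gamma>) * h ^ w \<gamma>)"
    have "1 / (fact m * h ^ m) * (\<Sum>r\<le>m. (-1) ^ (m - r) * of_nat (m choose r) *
            (\<Sum>\<gamma>\<in>\<Gamma>. A \<gamma> * (of_nat r * h) ^ w \<gamma>)) = sum ?T \<Gamma>"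
      unfolding sum_distrib_left sum_distrib_right
      by (subst sum.swap) (simp add: power_mult_distrib ac_simps)
    also have "\<dots> = sum ?T {\<gamma>\<in>\<Gamma>. w \<gamma> = m} + sum ?T {\<gamma>\<in>\<Gamma>. m < w \<gamma>}"
    proof -
      have "sum ?T \<Gamma> = sum ?T ({\<gamma>\<in>\<Gamma>. w \<gamma> = m} \<union> {\<gamma>\<in>\<Gamma>. m < w \<gamma>})"
        using assms by (intro sum.mono_neutral_right) (auto simp: alternating_binomial_power_sum)
      then show ?thesis using assms by (subst (asm) sum.union_disjoint) auto
    qed
    also have "sum ?T {\<gamma>\<in>\<Gamma>. w \<gamma> = m} = sum A {\<gamma>\<in>\<Gamma>. w \<gamma> = m}"
      using that by (intro sum.cong) (auto simp: alternating_binomial_power_sum)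
    also have "sum ?T {\<gamma>\<in>\<Gamma>. m < w \<gamma>} = ?R h"
      using that by (intro sum.cong refl) (auto simp: power_diff)
    finally show ?thesis by simp
  qed
  have "(\<lambda>h::'a. h ^ (w \<gamma> - m)) \<in> O[at 0](\<lambda>h. h)" if "m < w \<gamma>" for \<gamma>
  proof -
    \<comment> \<open>Radius 1 suffices: there a power with exponent at least 1 is bounded in norm
      by \<open>norm h\<close>.\<close>
    have "\<forall>\<^sub>F h::'a in at 0. norm (h ^ (w \<gamma> - m)) \<le> 1 * norm h"
      unfolding eventually_at
    proof (intro exI[of _ 1] conjI ballI impI)
      fix h :: 'a assume "h \<noteq> 0 \<and> dist h 0 < 1"
      then show "norm (h ^ (w \<gamma> - m)) \<le> 1 * norm h"
        using that power_decreasing[of 1 "w \<gamma> - m" "norm h"] by (simp add: norm_power)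
    qed simp
    then show ?thesis by (rule bigoI)
  qed
  then have "?R \<in> O[at 0](\<lambda>h. h)"
    by (intro big_sum_in_bigo landau_o.big.mult_in_1) auto
  \<comment> \<open>The filter \<open>at 0\<close> omits the point 0, so the identity for
    \<open>h \<noteq> 0\<close> transfers the bound.\<close>
  then show ?thesis
    by (subst landau_o.big.in_cong[of _ ?R]) (auto simp only: eventually_at_filter intro!: always_eventually eq)
qed

theorem proposition6:
  fixes n :: nat and a :: "nat \<Rightarrow> nat"
    and c :: "'d::{finite,linorder} \<Rightarrow> nat \<Rightarrow> 'a::real_normed_field"
    and p :: "('a, 'd) mpolynomial" and \<xi> :: "'a ^ 'd::{finite,linorder}" and m :: nat
  assumes "n \<ge> 1"
    and "a 0 = 1"
    and "\<And>j k. 1 \<le> j \<Longrightarrow> j < k \<Longrightarrow> k \<le> n \<Longrightarrow> a j > a k"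
    and "a n \<ge> 2"
    and "\<exists>i. c i 0 \<noteq> 0"
    and "m \<le> a 1"
  shows "(\<lambda>h. 1 / (fact m * h ^ m) *
            (\<Sum>r\<le>m. (-1) ^ (m - r) * of_nat (m choose r) *
               mpoly_eval p (\<xi> + (\<chi> i. \<Sum>j\<le>n. c i j * (of_nat r * h) ^ a j)))
            - diff_op (q_poly n a c m) (mpoly_eval p) \<xi>)
         \<in> O[at 0](\<lambda>h. h)"
proof -
  \<comment> \<open>Interior values exceed \<open>a n\<close>, and both end values are
    positive.\<close>
  have a: "a j > 0" if "j \<le> n" for j
  proof (cases "1 \<le> j \<and> j < n")
    case True
    then show ?thesis using assms(3)[of j n] by simp
  next
    case False
    then have "j = 0 \<or> j = n" using that by auto
    then show ?thesis using assms(2,4) by auto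
  qed
  \<comment> \<open>Bounding the exponents of \<open>p\<close> makes the expansion exact; including
    \<open>m\<close> makes room for all tuples of weight \<open>m\<close> and keeps the set nonempty
    when \<open>p = 0\<close>.\<close>
  define N where "N = Max (insert m ((\<lambda>(\<alpha>, i). \<alpha> $ i) ` (Poly_Mapping.keys p \<times> (UNIV :: 'd set))))"
  have fin: "finite (insert m ((\<lambda>(\<alpha>, i). \<alpha> $ i) ` (Poly_Mapping.keys p \<times> (UNIV :: 'd set))))"
    by auto
  have N: "\<alpha> $ i \<le> N" if "\<alpha> \<in> Poly_Mapping.keys p" for \<alpha> i
    unfolding N_def using that by (intro Max_ge[OF fin]) force
  have mN: "m \<le> N"
    unfolding N_def by (intro Max_ge[OF fin]) simp
  let ?w = "\<lambda>\<gamma> :: 'd \<Rightarrow> nat \<Rightarrow> nat. \<Sum>j\<le>n. a j * (\<Sum>i\<in>UNIV. \<gamma> i j)"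
  \<comment> \<open>Bounded tuples vanish for \<open>j > n\<close>, so among them the weight alone
    decides membership.\<close>
  have "weight_tuples n a m = {\<gamma> \<in> bounded_tuples n N. ?w \<gamma> = m}"
    using weight_tuples_subset_bounded_tuples[of n a m N] a mN
    by (auto simp: weight_tuples_def dest: bounded_tuples_eq_0)
  then have "diff_op (q_poly n a c m) (mpoly_eval p) \<xi> = (\<Sum>\<gamma>\<in>{\<gamma> \<in> bounded_tuples n N. ?w \<gamma> = m}.
      ((\<Prod>i\<in>UNIV. \<Prod>j\<le>n. c i j ^ \<gamma> i j) / (\<Prod>i\<in>UNIV. \<Prod>j\<le>n. fact (\<gamma> i j))) *
       mixed_deriv (\<chi> i. \<Sum>j\<le>n. \<gamma> i j) (mpoly_eval p) \<xi>)"
    unfolding q_poly_def by (simp add: diff_op_sum_single finite_bounded_tuples)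
  then show ?thesis
    using difference_quotient_generalized_polynomial[OF finite_bounded_tuples]
    by (simp only: mpoly_eval_along_curve[OF N])
qed

end
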